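(* Let $\mathcal{C}$ be a chordal clutter on vertex set $V$ with minimum circuit cardinality $d$. Then the Alexander dual (over $V$) of $I(c_d(\mathcal{C}))$ is vertex decomposable.
   Context: A clutter on finite vertex set $V$ is a set of subsets (circuits) of $V$, none properly containing another; minimum circuit cardinality is the smallest circuit size. $I(\mathcal{D})$ is the simplicial complex on $V$ of subsets containing no circuit of $\mathcal{D}$. $c_d(\mathcal{C})$ is the clutter on $V$ whose circuits are the $d$-subsets of $V$ that are not circuits of $\mathcal{C}$. Deletion $\mathcal{C}\setminus u$: clutter on $V\setminus\{u\}$ with the circuits not containing $u$; contraction $\mathcal{C}/u$: clutter on $V\setminus\{u\}$ whose circuits are the minimal sets among $\{e\setminus\{u\}\}$; a minor arises from a (possibly empty) sequence of these. A vertex $v$ is simplicial if for every two circuits $e_1,e_2\ni v$ there is a circuit $e_3\subseteq(e_1\cup e_2)\setminus\{v\}$; $\mathcal{C}$ is chordal if every minor (with at least one vertex) has a simplicial vertex. The Alexander dual over $V$ of a complex $\Delta$ on $V$ has facets $V\setminus e$ for $e$ a minimal non-face of $\Delta$. A complex $\Delta$ on vertex set $W$ is vertex decomposable if it is a simplex, or $\{\}$ or $\{\emptyset\}$, or it has a vertex $v$ such that every face $\tau\ni v$ admits $w\in W\setminus\tau$ with $(\tau\cup\{w\})\setminus\{v\}\in\Delta$, and both $\Delta\setminus v$ (faces not containing $v$) and $\operatorname{link}_\Delta v=\{\tau:v\notin\tau,\tau\cup\{v\}\in\Delta\}$ are vertex decomposable. *)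

theory Defs
  imports Main
begin

definition clutter :: "'a set \<Rightarrow> 'a set set \<Rightarrow> bool" where
  "clutter V C \<longleftrightarrow>
     finite V \<and> C \<subseteq> Pow V \<and> (\<forall>e\<in>C. \<forall>f\<in>C. \<not> e \<subset> f)"

(* On the vertex set V - {u}; the vertex set is tracked separately. *)
definition clutter_deletion :: "'a set set \<Rightarrow> 'a \<Rightarrow> 'a set set" where
  "clutter_deletion C u = {e \<in> C. u \<notin> e}"

definition clutter_contraction :: "'a set set \<Rightarrow> 'a \<Rightarrow> 'a set set" where
  "clutter_contraction C u =
     {f \<in> (\<lambda>e. e - {u}) ` C. \<forall>g \<in> (\<lambda>e. e - {u}) ` C. \<not> g \<subset> f}"

inductive minor :: "'a set \<Rightarrow> 'a set set \<Rightarrow> 'a set \<Rightarrow> 'a set set \<Rightarrow> bool"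
  for V :: "'a set" and C :: "'a set set" where
  minor_refl: "minor V C V C"
| minor_deletion:
    "minor V C W D \<Longrightarrow> u \<in> W \<Longrightarrow> minor V C (W - {u}) (clutter_deletion D u)"
| minor_contraction:
    "minor V C W D \<Longrightarrow> u \<in> W \<Longrightarrow> minor V C (W - {u}) (clutter_contraction D u)"

(* The two circuits are distinct: for e1 = e2 the condition would contradict
   the clutter property, so that no vertex of a circuit could be simplicial. *)
definition simplicial_vertex :: "'a set \<Rightarrow> 'a set set \<Rightarrow> 'a \<Rightarrow> bool" where
  "simplicial_vertex V C v \<longleftrightarrow> v \<in> V \<and>
     (\<forall>e1\<in>C. \<forall>e2\<in>C. e1 \<noteq> e2 \<and> v \<in> e1 \<and> v \<in> e2 \<longrightarrow>
        (\<exists>e3\<in>C. e3 \<subseteq> (e1 \<union> e2) - {v}))"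

definition chordal :: "'a set \<Rightarrow> 'a set set \<Rightarrow> bool" where
  "chordal V C \<longleftrightarrow>
     (\<forall>W D. minor V C W D \<and> W \<noteq> {} \<longrightarrow> (\<exists>v. simplicial_vertex W D v))"

definition d_complement :: "nat \<Rightarrow> 'a set \<Rightarrow> 'a set set \<Rightarrow> 'a set set" where
  "d_complement d V C = {e. e \<subseteq> V \<and> card e = d \<and> e \<notin> C}"

(* The void complex {} is allowed, and elements of V need not be faces. *)
definition simplicial_complex :: "'a set \<Rightarrow> 'a set set \<Rightarrow> bool" where
  "simplicial_complex V \<Delta> \<longleftrightarrow>
     finite V \<and> \<Delta> \<subseteq> Pow V \<and> (\<forall>\<tau>\<in>\<Delta>. \<forall>\<sigma>. \<sigma> \<subseteq> \<tau> \<longrightarrow> \<sigma> \<in> \<Delta>)"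

definition independence_complex :: "'a set \<Rightarrow> 'a set set \<Rightarrow> 'a set set" where
  "independence_complex V D = {\<sigma>. \<sigma> \<subseteq> V \<and> (\<forall>e\<in>D. \<not> e \<subseteq> \<sigma>)}"

definition minimal_nonfaces :: "'a set \<Rightarrow> 'a set set \<Rightarrow> 'a set set" where
  "minimal_nonfaces V \<Delta> = {e. e \<subseteq> V \<and> e \<notin> \<Delta> \<and> (\<forall>f. f \<subset> e \<longrightarrow> f \<in> \<Delta>)}"

definition alexander_dual :: "'a set \<Rightarrow> 'a set set \<Rightarrow> 'a set set" where
  "alexander_dual V \<Delta> = {\<tau>. \<exists>e \<in> minimal_nonfaces V \<Delta>. \<tau> \<subseteq> V - e}"

definition complex_deletion :: "'a set set \<Rightarrow> 'a \<Rightarrow> 'a set set" where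
  "complex_deletion \<Delta> v = {\<tau> \<in> \<Delta>. v \<notin> \<tau>}"

definition link :: "'a set set \<Rightarrow> 'a \<Rightarrow> 'a set set" where
  "link \<Delta> v = {\<tau>. v \<notin> \<tau> \<and> \<tau> \<union> {v} \<in> \<Delta>}"

definition shedding :: "'a set \<Rightarrow> 'a set set \<Rightarrow> 'a \<Rightarrow> bool" where
  "shedding W \<Delta> v \<longleftrightarrow>
     (\<forall>\<tau>\<in>\<Delta>. v \<in> \<tau> \<longrightarrow> (\<exists>w \<in> W - \<tau>. (\<tau> \<union> {w}) - {v} \<in> \<Delta>))"

(* In the rule vd_shed, v is required to be an actual vertex of \<Delta>, i.e. {v} is a
   face. Allowing every v in W gives the same notion: for a non-face {v} the
   deletion is \<Delta> itself and the link is void. *)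
inductive vertex_decomposable :: "'a set \<Rightarrow> 'a set set \<Rightarrow> bool" where
  vd_simplex: "simplicial_complex W (Pow F) \<Longrightarrow> vertex_decomposable W (Pow F)"
| vd_void: "simplicial_complex W {} \<Longrightarrow> vertex_decomposable W {}"
| vd_empty_face: "simplicial_complex W {{}} \<Longrightarrow> vertex_decomposable W {{}}"
| vd_shed:
    "simplicial_complex W \<Delta> \<Longrightarrow> {v} \<in> \<Delta> \<Longrightarrow> shedding W \<Delta> v \<Longrightarrow>
     vertex_decomposable (W - {v}) (complex_deletion \<Delta> v) \<Longrightarrow>
     vertex_decomposable (W - {v}) (link \<Delta> v) \<Longrightarrow>
     vertex_decomposable W \<Delta>"

end

(* Write A(V, C, d) for the complex of all sets avoiding some d-subset of V that is not a circuit
   of C; this is the Alexander dual in question. If all circuits have at least d elements and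
   d > 1, then a simplicial vertex v of C is a shedding vertex of A(V, C, d): if v is not in the
   noncircuit e but all the sets e - {w} + {v} were circuits, then two of them would yield a
   circuit inside e, which by cardinality is e itself. Moreover the link of v is
   A(V - {v}, C \ v, d) and the deletion of v is A(V - {v}, C / v, d - 1), so induction on V
   applies. For d = 1 the complex is a simplex joined with the boundary of a simplex. *)
theory Submission imports Defs begin

section \<open>The dual described through noncircuits of size \<open>d\<close>\<close>

definition noncircuit_dual :: "nat \<Rightarrow> 'a set \<Rightarrow> 'a set set \<Rightarrow> 'a set set" where
  "noncircuit_dual d V C =
     {\<tau>. \<tau> \<subseteq> V \<and> (\<exists>e. e \<subseteq> V - \<tau> \<and> card e = d \<and> e \<notin> C)}"

text \<open>All members of the \<open>d\<close>-complement have the same size, so none properly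
  contains another, and the minimal nonfaces are exactly these generators.\<close>

lemma minimal_nonfaces_independence_complex:
  assumes "finite V"
  shows "minimal_nonfaces V (independence_complex V (d_complement d V C)) = d_complement d V C"
    (is "?M = ?D")
proof (rule set_eqI)
  fix e
  show "e \<in> ?M \<longleftrightarrow> e \<in> ?D"
  proof
    assume e: "e \<in> ?M"
    then obtain e' where e': "e' \<in> ?D" "e' \<subseteq> e"
      by (auto simp: minimal_nonfaces_def independence_complex_def)
    then have "e' \<notin> independence_complex V ?D"
      by (auto simp: independence_complex_def)
    with e e' have "e' = e"
      by (auto simp: minimal_nonfaces_def)
    with e' show "e \<in> ?D" by simp
  next
    assume e: "e \<in> ?D"
    have "\<not> g \<subseteq> f" if "f \<subset> e" "g \<in> ?D" for f g
    proof
      assume "g \<subseteq> f"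
      with that have "g \<subset> e" by blast
      moreover have "finite e"
        using e assms by (auto simp: d_complement_def intro: finite_subset)
      ultimately have "card g < card e" by (simp add: psubset_card_mono)
      with e that show False by (simp add: d_complement_def)
    qed
    with e show "e \<in> ?M"
      by (auto simp: minimal_nonfaces_def independence_complex_def d_complement_def)
  qed
qed

lemma alexander_dual_d_complement:
  assumes "finite V"
  shows "alexander_dual V (independence_complex V (d_complement d V C)) = noncircuit_dual d V C"
  unfolding alexander_dual_def minimal_nonfaces_independence_complex[OF assms]
  by (auto simp: noncircuit_dual_def d_complement_def)

section \<open>Minors, and change of the ground set\<close>

lemma minor_trans:
  assumes "minor W D X E" and "minor V C W D"
  shows "minor V C X E"
  using assms by induction (auto intro: minor.intros)

lemma chordal_minor:
  assumes "chordal V C" and "minor V C W D"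
  shows "chordal W D"
  using assms unfolding chordal_def by (blast intro: minor_trans)

lemma simplicial_complex_noncircuit_dual:
  assumes "finite V"
  shows "simplicial_complex V (noncircuit_dual d V C)"
  unfolding simplicial_complex_def
proof (intro conjI ballI allI impI)
  fix \<tau> \<sigma>
  assume "\<tau> \<in> noncircuit_dual d V C" and \<sigma>: "\<sigma> \<subseteq> \<tau>"
  then obtain e where e: "\<tau> \<subseteq> V" "e \<subseteq> V - \<tau>" "card e = d" "e \<notin> C"
    by (auto simp: noncircuit_dual_def)
  from e(1,2) \<sigma> have "\<sigma> \<subseteq> V" "e \<subseteq> V - \<sigma>" by blast+
  with e show "\<sigma> \<in> noncircuit_dual d V C"
    unfolding noncircuit_dual_def by blast
qed (use assms in \<open>auto simp: noncircuit_dual_def\<close>)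

text \<open>A larger ground set only offers more candidates \<open>w\<close> in the shedding
  condition. This serves the case where the chosen simplicial vertex is not a face of the
  complex.\<close>

lemma vertex_decomposable_mono:
  assumes "vertex_decomposable W \<Delta>" and "W \<subseteq> W'" and "finite W'"
  shows "vertex_decomposable W' \<Delta>"
  using assms
proof (induction arbitrary: W')
  case (vd_simplex W F)
  then show ?case
    by (intro vertex_decomposable.vd_simplex) (auto simp: simplicial_complex_def)
next
  case (vd_void W)
  then show ?case
    by (intro vertex_decomposable.vd_void) (auto simp: simplicial_complex_def)
next
  case (vd_empty_face W)
  then show ?case
    by (intro vertex_decomposable.vd_empty_face) (auto simp: simplicial_complex_def)
next
  case (vd_shed W \<Delta> v)
  show ?case
  proof (rule vertex_decomposable.vd_shed)
    show "simplicial_complex W' \<Delta>"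
      using vd_shed.hyps(1) vd_shed.prems by (auto simp: simplicial_complex_def)
    show "shedding W' \<Delta> v"
      using vd_shed.hyps(3) vd_shed.prems unfolding shedding_def by blast
    show "{v} \<in> \<Delta>" by fact
    show "vertex_decomposable (W' - {v}) (complex_deletion \<Delta> v)"
      using vd_shed.prems by (intro vd_shed.IH) auto
    show "vertex_decomposable (W' - {v}) (link \<Delta> v)"
      using vd_shed.prems by (intro vd_shed.IH) auto
  qed
qed

section \<open>Base cases: noncircuits of size zero and one\<close>

lemma vertex_decomposable_Pow:
  assumes "F \<subseteq> W" and "finite W"
  shows "vertex_decomposable W (Pow F)"
  using assms by (intro vd_simplex) (auto simp: simplicial_complex_def)

text \<open>The complex is the join of the simplex on \<open>V - S\<close> with the boundary of the
  simplex on \<open>S\<close>. Shedding any element of \<open>S\<close> leaves a simplex as deletion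
  and a complex of the same form, with a smaller \<open>S\<close>, as link.\<close>

lemma vertex_decomposable_not_superset:
  assumes "finite V" and "S \<subseteq> V"
  shows "vertex_decomposable V {\<tau>. \<tau> \<subseteq> V \<and> \<not> S \<subseteq> \<tau>}"
proof -
  have "finite S" using assms by (rule rev_finite_subset)
  then show ?thesis using assms
  proof (induction arbitrary: V)
    case empty
    then show ?case by (auto intro!: vd_void simp: simplicial_complex_def)
  next
    case (insert v S)
    let ?\<Delta> = "{\<tau>. \<tau> \<subseteq> V \<and> \<not> insert v S \<subseteq> \<tau>}"
    have del: "complex_deletion ?\<Delta> v = Pow (V - {v})"
      by (auto simp: complex_deletion_def)
    show ?case
    \<comment> \<open>If \<open>S\<close> is empty, \<open>{v}\<close> is not a face, so
      \<open>v\<close> cannot be shed; the complex is then already a simplex.\<close>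
    proof (cases "S = {}")
      case True
      then have "?\<Delta> = Pow (V - {v})" by auto
      then show ?thesis
        using insert.prems by (simp add: vertex_decomposable_Pow)
    next
      case False
      have lnk: "link ?\<Delta> v = {\<tau>. \<tau> \<subseteq> V - {v} \<and> \<not> S \<subseteq> \<tau>}"
        using insert.hyps insert.prems by (auto simp: link_def)
      show ?thesis
      proof (rule vd_shed)
        show "simplicial_complex V ?\<Delta>"
          using insert.prems by (auto simp: simplicial_complex_def)
        show "{v} \<in> ?\<Delta>"
          using False insert.hyps insert.prems by auto
        \<comment> \<open>A face containing \<open>v\<close> misses some element of
          \<open>insert v S\<close>, which serves as \<open>w\<close>; the exchanged set is a face
          because it misses \<open>v\<close>.\<close>
        show "shedding V ?\<Delta> v"
          using insert.prems unfolding shedding_def by fastforce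
        show "vertex_decomposable (V - {v}) (complex_deletion ?\<Delta> v)"
          unfolding del using insert.prems by (simp add: vertex_decomposable_Pow)
        show "vertex_decomposable (V - {v}) (link ?\<Delta> v)"
          unfolding lnk using insert.hyps insert.prems by (intro insert.IH) auto
      qed
    qed
  qed
qed

lemma vertex_decomposable_noncircuit_dual_1:
  assumes "finite V"
  shows "vertex_decomposable V (noncircuit_dual 1 V C)"
proof -
  \<comment> \<open>A face avoids some noncircuit singleton exactly when it does not contain all
    their elements.\<close>
  have "noncircuit_dual 1 V C = {\<tau>. \<tau> \<subseteq> V \<and> \<not> {w \<in> V. {w} \<notin> C} \<subseteq> \<tau>}"
    by (auto simp: noncircuit_dual_def card_1_singleton_iff)
  then show ?thesis
    using vertex_decomposable_not_superset[OF assms, of "{w \<in> V. {w} \<notin> C}"] by simp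
qed

lemma vertex_decomposable_noncircuit_dual_0:
  assumes "finite V"
  shows "vertex_decomposable V (noncircuit_dual 0 V C)"
proof -
  \<comment> \<open>Finiteness of \<open>V\<close> rules out infinite \<open>e\<close>, whose
    \<open>card\<close> is 0 by default.\<close>
  have "e \<subseteq> V - \<tau> \<and> card e = 0 \<longleftrightarrow> e = {}" for e \<tau>
    using assms by (metis card_0_eq card.empty empty_subsetI finite_Diff finite_subset)
  then have "noncircuit_dual 0 V C = {\<tau>. \<tau> \<subseteq> V \<and> {} \<notin> C}"
    unfolding noncircuit_dual_def by metis
  then have "noncircuit_dual 0 V C = (if {} \<in> C then {} else Pow V)"
    by auto
  then show ?thesis
    using assms by (auto intro: vertex_decomposable_Pow vd_void simp: simplicial_complex_def)
qed

section \<open>Link, deletion and shedding\<close>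

lemma link_noncircuit_dual:
  assumes "v \<in> V"
  shows "link (noncircuit_dual d V C) v = noncircuit_dual d (V - {v}) (clutter_deletion C v)"
proof (rule set_eqI)
  fix \<tau>
  have "v \<notin> \<tau> \<and> \<tau> \<union> {v} \<subseteq> V \<longleftrightarrow> \<tau> \<subseteq> V - {v}"
    using assms by blast
  moreover have "V - (\<tau> \<union> {v}) = V - {v} - \<tau>" by blast
  \<comment> \<open>Noncircuits avoiding \<open>\<tau> \<union> {v}\<close> do not contain
    \<open>v\<close>, so deleting \<open>v\<close> from the clutter does not affect their
    status.\<close>
  moreover have "e \<in> clutter_deletion C v \<longleftrightarrow> e \<in> C" if "e \<subseteq> V - {v} - \<tau>" for e
    using that by (auto simp: clutter_deletion_def)
  ultimately show "\<tau> \<in> link (noncircuit_dual d V C) v \<longleftrightarrow>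
      \<tau> \<in> noncircuit_dual d (V - {v}) (clutter_deletion C v)"
    unfolding link_def noncircuit_dual_def mem_Collect_eq by metis
qed

lemma clutter_contraction_card_ge:
  assumes "\<forall>e\<in>C. Suc d \<le> card e" and "f \<in> clutter_contraction C v"
  shows "d \<le> card f"
proof -
  from assms(2) obtain e where "e \<in> C" "f = e - {v}"
    by (auto simp: clutter_contraction_def)
  with assms(1) show ?thesis
    by (auto simp: card_Diff_singleton_if dest!: bspec)
qed

text \<open>Removing \<open>v\<close> lowers sizes by at most one, so \<open>d\<close> is the least
  size possible after contraction and minimality is automatic for sets of that size.\<close>

lemma mem_clutter_contraction_iff:
  assumes "\<forall>e\<in>C. Suc d \<le> card e" and "finite f" and "card f = d" and "v \<notin> f"
  shows "f \<in> clutter_contraction C v \<longleftrightarrow> insert v f \<in> C"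
proof
  assume "f \<in> clutter_contraction C v"
  then obtain e where e: "e \<in> C" "f = e - {v}"
    by (auto simp: clutter_contraction_def)
  \<comment> \<open>Otherwise \<open>e = f\<close> would be a circuit with only \<open>d\<close>
    elements.\<close>
  with assms have "v \<in> e" by force
  with e show "insert v f \<in> C" by (simp add: insert_absorb)
next
  assume "insert v f \<in> C"
  moreover have "\<not> e - {v} \<subset> f" if "e \<in> C" for e
  proof
    assume "e - {v} \<subset> f"
    then have "card (e - {v}) < d"
      using assms by (auto dest: psubset_card_mono)
    with assms(1) that show False
      by (auto simp: card_Diff_singleton_if dest!: bspec split: if_splits)
  qed
  moreover have "f = insert v f - {v}"
    using assms(4) by simp
  ultimately show "f \<in> clutter_contraction C v"
    unfolding clutter_contraction_def by blast
qed

text \<open>The only place where simpliciality itself enters; both the deletion formula and the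
  shedding property rest on this exchange.\<close>

lemma exchange_noncircuit:
  assumes "simplicial_vertex V C v" and "\<forall>f\<in>C. Suc (Suc d) \<le> card f"
    and "card e = Suc (Suc d)" and "e \<notin> C" and "v \<notin> e"
  obtains w where "w \<in> e" and "insert v (e - {w}) \<notin> C"
proof -
  have "finite e" using assms(3) by (metis card.infinite nat.distinct(1))
  \<comment> \<open>Noncircuits have at least two elements here, so two different exchanges are
    available.\<close>
  obtain w w' where w: "w \<in> e" "w' \<in> e" "w \<noteq> w'"
    using assms(3) by (metis card_Suc_eq insertI1 insertI2)
  have "insert v (e - {w}) \<notin> C \<or> insert v (e - {w'}) \<notin> C"
  proof (rule ccontr)
    assume "\<not> ?thesis"
    then have mem: "insert v (e - {w}) \<in> C" "insert v (e - {w'}) \<in> C" by simp_all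
    \<comment> \<open>Simpliciality speaks only of distinct circuits; these two differ at
      \<open>w\<close>, which lies in the second alone.\<close>
    have neq: "insert v (e - {w}) \<noteq> insert v (e - {w'})"
      using w assms(5) by (metis Diff_iff insertCI insertE singletonD singletonI)
    obtain g where g: "g \<in> C" "g \<subseteq> (insert v (e - {w}) \<union> insert v (e - {w'})) - {v}"
      using assms(1)[unfolded simplicial_vertex_def, THEN conjunct2, rule_format, OF mem] neq
      by auto
    then have "g \<subseteq> e" by auto
    moreover have "card e \<le> card g" using g assms by simp
    ultimately have "g = e" using \<open>finite e\<close> by (simp add: card_seteq)
    with g assms show False by simp
  qed
  with w that show thesis by blast
qed

text \<open>By exchange, the noncircuit avoided by a face without \<open>v\<close> can be chosen to
  contain \<open>v\<close>. Removing or inserting \<open>v\<close> then matches noncircuits of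
  \<open>C\<close> through \<open>v\<close> with noncircuits of the contraction that are one element
  smaller.\<close>

lemma complex_deletion_noncircuit_dual:
  assumes "finite V" and v: "simplicial_vertex V C v" and ge: "\<forall>f\<in>C. Suc (Suc d) \<le> card f"
  shows "complex_deletion (noncircuit_dual (Suc (Suc d)) V C) v =
         noncircuit_dual (Suc d) (V - {v}) (clutter_contraction C v)" (is "?L = ?R")
proof (rule set_eqI)
  fix \<tau>
  have "v \<in> V" using v by (simp add: simplicial_vertex_def)
  show "\<tau> \<in> ?L \<longleftrightarrow> \<tau> \<in> ?R"
  proof
    assume "\<tau> \<in> ?L"
    then obtain e where \<tau>: "\<tau> \<subseteq> V - {v}"
      and e: "e \<subseteq> V - \<tau>" "card e = Suc (Suc d)" "e \<notin> C"
      by (auto simp: complex_deletion_def noncircuit_dual_def)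
    have "\<exists>e'. v \<in> e' \<and> e' \<subseteq> V - \<tau> \<and> card e' = Suc (Suc d) \<and> e' \<notin> C"
    proof (cases "v \<in> e")
      case False
      with exchange_noncircuit[OF v ge] e obtain w
        where w: "w \<in> e" "insert v (e - {w}) \<notin> C" by blast
      have "finite e" using e(1) assms(1) by (auto intro: finite_subset)
      with w e False have "card (insert v (e - {w})) = Suc (Suc d)"
        by (simp add: card.insert_remove)
      with w e \<tau> \<open>v \<in> V\<close> show ?thesis by (intro exI[of _ "insert v (e - {w})"]) auto
    qed (use e in blast)
    then obtain e' where e': "v \<in> e'" "e' \<subseteq> V - \<tau>" "card e' = Suc (Suc d)" "e' \<notin> C"
      by blast
    have fin: "finite e'" using e'(2) assms(1) by (auto intro: finite_subset)
    then have "card (e' - {v}) = Suc d" using e' by simp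
    moreover from this have "e' - {v} \<notin> clutter_contraction C v"
      using mem_clutter_contraction_iff[OF ge, of "e' - {v}" v] fin e' by (simp add: insert_absorb)
    moreover have "e' - {v} \<subseteq> V - {v} - \<tau>" using e'(2) by blast
    ultimately show "\<tau> \<in> ?R"
      using \<tau> unfolding noncircuit_dual_def by blast
  next
    assume "\<tau> \<in> ?R"
    then obtain f where \<tau>: "\<tau> \<subseteq> V - {v}"
      and f: "f \<subseteq> V - {v} - \<tau>" "card f = Suc d" "f \<notin> clutter_contraction C v"
      by (auto simp: noncircuit_dual_def)
    have "finite f" "v \<notin> f" using f(1) assms(1) by (auto intro: finite_subset)
    moreover from this have "insert v f \<notin> C"
      using mem_clutter_contraction_iff[OF ge] f by blast
    moreover have "insert v f \<subseteq> V - \<tau>" using \<tau> f(1) \<open>v \<in> V\<close> by blast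
    moreover have "card (insert v f) = Suc (Suc d)"
      using f(2) calculation by simp
    ultimately have "\<tau> \<in> noncircuit_dual (Suc (Suc d)) V C"
      using \<tau> unfolding noncircuit_dual_def by blast
    with \<tau> show "\<tau> \<in> ?L"
      by (auto simp: complex_deletion_def)
  qed
qed

lemma shedding_noncircuit_dual:
  assumes v: "simplicial_vertex V C v" and ge: "\<forall>f\<in>C. Suc (Suc d) \<le> card f"
  shows "shedding V (noncircuit_dual (Suc (Suc d)) V C) v"
  unfolding shedding_def
proof (intro ballI impI)
  fix \<tau>
  assume "\<tau> \<in> noncircuit_dual (Suc (Suc d)) V C" and "v \<in> \<tau>"
  then obtain e where \<tau>: "\<tau> \<subseteq> V" and e: "e \<subseteq> V - \<tau>" "card e = Suc (Suc d)" "e \<notin> C" "v \<notin> e"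
    by (auto simp: noncircuit_dual_def)
  from exchange_noncircuit[OF v ge e(2-4)] obtain w
    where w: "w \<in> e" "insert v (e - {w}) \<notin> C" .
  have "finite e" using e(2) by (metis card.infinite nat.distinct(1))
  with w e have "card (insert v (e - {w})) = Suc (Suc d)"
    by (simp add: card.insert_remove)
  \<comment> \<open>The face gives up \<open>v\<close> and receives \<open>w\<close>, while the
    noncircuit does the reverse, so the two remain disjoint.\<close>
  moreover have "insert v (e - {w}) \<subseteq> V - (\<tau> \<union> {w} - {v})"
    using w e \<tau> \<open>v \<in> \<tau>\<close> by auto
  ultimately have "\<tau> \<union> {w} - {v} \<in> noncircuit_dual (Suc (Suc d)) V C"
    using w e \<tau> unfolding noncircuit_dual_def by blast
  with w e show "\<exists>w \<in> V - \<tau>. \<tau> \<union> {w} - {v} \<in> noncircuit_dual (Suc (Suc d)) V C"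
    by blast
qed

section \<open>Induction on the vertex set\<close>

lemma vertex_decomposable_noncircuit_dual:
  assumes "finite V" and "chordal V C" and "\<forall>e\<in>C. d \<le> card e"
  shows "vertex_decomposable V (noncircuit_dual d V C)"
  using assms
\<comment> \<open>A lower bound on circuit sizes is inherited, while an exact minimum need not be:
  deletion may remove all smallest circuits. Contraction lowers the bound by one, hence
  \<open>d\<close> varies along with \<open>C\<close>.\<close>
proof (induction V arbitrary: C d rule: finite_psubset_induct)
  case (psubset V)
  consider "d = 0" | "d = 1" | d' where "d = Suc (Suc d')"
    by (metis One_nat_def not0_implies_Suc)
  then show ?case
  proof cases
    case 3
    let ?\<Delta> = "noncircuit_dual d V C"
    note ge = psubset.prems(2)[unfolded 3]
    show ?thesis
    \<comment> \<open>Chordality supplies a simplicial vertex only when \<open>V\<close> is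
      nonempty.\<close>
    proof (cases "V = {}")
      case True
      then have "?\<Delta> = {}" using 3 by (auto simp: noncircuit_dual_def)
      then show ?thesis
        using psubset.hyps by (auto intro: vd_void simp: simplicial_complex_def)
    next
      case False
      then obtain v where v: "simplicial_vertex V C v"
        using psubset.prems(1) minor_refl unfolding chordal_def by blast
      then have "v \<in> V" by (simp add: simplicial_vertex_def)
      then have less: "V - {v} \<subset> V" by blast
      have "vertex_decomposable (V - {v})
          (noncircuit_dual (Suc d') (V - {v}) (clutter_contraction C v))"
        using chordal_minor[OF psubset.prems(1)
            minor_contraction[OF minor_refl \<open>v \<in> V\<close>]] clutter_contraction_card_ge[OF ge]
        by (intro psubset.IH less) auto
      then have del: "vertex_decomposable (V - {v}) (complex_deletion ?\<Delta> v)"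
        unfolding 3 by (simp only: complex_deletion_noncircuit_dual[OF psubset.hyps v ge])
      have "vertex_decomposable (V - {v}) (noncircuit_dual d (V - {v}) (clutter_deletion C v))"
        using psubset.prems(2) chordal_minor[OF psubset.prems(1)
            minor_deletion[OF minor_refl \<open>v \<in> V\<close>]]
        by (intro psubset.IH less) (auto simp: clutter_deletion_def)
      then have lnk: "vertex_decomposable (V - {v}) (link ?\<Delta> v)"
        by (simp only: link_noncircuit_dual[OF \<open>v \<in> V\<close>])
      have complex: "simplicial_complex V ?\<Delta>"
        using psubset.hyps by (rule simplicial_complex_noncircuit_dual)
      show ?thesis
      proof (cases "{v} \<in> ?\<Delta>")
        case True
        then show ?thesis
          using shedding_noncircuit_dual[OF v ge] complex del lnk unfolding 3 by (blast intro: vd_shed)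
      next
        case False
        \<comment> \<open>No face contains \<open>v\<close>, so the deletion, already decomposable
          over \<open>V - {v}\<close>, is the whole complex; it remains to enlarge the ground
          set.\<close>
        with complex have "complex_deletion ?\<Delta> v = ?\<Delta>"
          by (fastforce simp: complex_deletion_def simplicial_complex_def)
        with del psubset.hyps show ?thesis
          by (metis Diff_subset vertex_decomposable_mono)
      qed
    qed
  qed (simp_all add: psubset.hyps vertex_decomposable_noncircuit_dual_0
      vertex_decomposable_noncircuit_dual_1[unfolded One_nat_def])
qed

theorem theorem6p9:
  fixes V :: "'a set" and C :: "'a set set" and d :: nat
  assumes "clutter V C"
    and "chordal V C"
    and "C \<noteq> {}"
    and "d = Min (card ` C)"
  shows "vertex_decomposable V
           (alexander_dual V (independence_complex V (d_complement d V C)))"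
proof -
  have "finite V" using assms(1) by (simp add: clutter_def)
  \<comment> \<open>Finiteness makes \<open>Min\<close> a genuine lower bound for the circuit
    sizes.\<close>
  moreover have "finite C"
    using assms(1) by (auto simp: clutter_def intro: finite_subset)
  ultimately show ?thesis
    using assms(2,4)
    by (simp add: alexander_dual_d_complement vertex_decomposable_noncircuit_dual)
qed

end
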